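(* Let $\mathcal{P}$ be a non-trivial graph property which is minor closed, or monotone, or hereditary. Then the Harary polynomial $\chi_{\mathcal{P}}(G;x)$ is an edge elimination invariant if and only if $\chi_{\mathcal{P}}(G;x)=\chi(G;x)$ for all graphs $G$, where $\chi(G;x)$ is the chromatic polynomial (equivalently, the Harary polynomial of the property consisting of all edgeless graphs).
   Context: All graphs are finite simple graphs; a graph property is a class of graphs closed under isomorphism. A graph property is trivial if it is empty, finite up to isomorphism, or contains all finite graphs; otherwise non-trivial. $\mathcal{P}$ is hereditary (monotone, minor closed) if it is closed under taking induced subgraphs (subgraphs, minors). For a graph $G$ and $i\ge 0$, let $b_i^{\mathcal{P}}(G)$ be the number of partitions of $V(G)$ into $i$ nonempty blocks such that each block induces a subgraph of $G$ belonging to $\mathcal{P}$ (so $b_0^{\mathcal{P}}(G)=1$ if $G$ is the null graph with no vertices, and $0$ otherwise). The Harary polynomial is $\chi_{\mathcal{P}}(G;x)=\sum_{i\ge 0} b_i^{\mathcal{P}}(G)\,x_{(i)}\in\mathbb{Z}[x]$, where $x_{(i)}=x(x-1)\cdots(x-i+1)$ is the falling factorial; for a positive integer $k$, $\chi_{\mathcal{P}}(G;k)$ is the number of maps $c:V(G)\to\{1,\dots,k\}$ such that every nonempty color class induces a graph in $\mathcal{P}$. For an edge $e=uv$ of $G$: $G_{-e}$ is obtained by deleting $e$; $G_{/e}$ by contracting $e$ (identifying $u$ and $v$, keeping the graph simple); $G_{\dagger e}$ (extraction) by deleting $u$, $v$ and all edges incident with $u$ or $v$. A graph parameter $F$ with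 values in $\mathbb{Z}[x]$ is an edge elimination (EE-)invariant if there exist $\alpha,\beta,\gamma\in\mathbb{Z}[x]$ such that for every graph $G$ and every edge $e\in E(G)$, $F(G)=F(G_{-e})+\alpha F(G_{/e})+\beta F(G_{\dagger e})$, and moreover $F(\emptyset)=1$ for the null graph $\emptyset$, $F(K_1)=\gamma$, and $F(G\sqcup H)=F(G)\cdot F(H)$ for all graphs $G,H$ ($\sqcup$ = disjoint union). *)

theory Defs
  imports
    "HOL-Library.FuncSet"
    "HOL-Library.Disjoint_Sets"
    "HOL-Computational_Algebra.Polynomial"
begin

section \<open>Finite simple graphs\<close>

type_synonym 'a ugraph = "'a set \<times> 'a set set"

abbreviation verts :: "'a ugraph \<Rightarrow> 'a set" where
  "verts \<equiv> fst"

abbreviation edges :: "'a ugraph \<Rightarrow> 'a set set" where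
  "edges \<equiv> snd"

definition simple_graph :: "'a ugraph \<Rightarrow> bool" where
  "simple_graph G \<longleftrightarrow> finite (verts G) \<and> (\<forall>e\<in>edges G. e \<subseteq> verts G \<and> card e = 2)"

definition graph_iso :: "'a ugraph \<Rightarrow> 'a ugraph \<Rightarrow> bool" where
  "graph_iso G H \<longleftrightarrow>
     (\<exists>f. bij_betw f (verts G) (verts H) \<and>
          (\<forall>u\<in>verts G. \<forall>v\<in>verts G. {u, v} \<in> edges G \<longleftrightarrow> {f u, f v} \<in> edges H))"

definition null_graph :: "'a ugraph" where
  "null_graph = ({}, {})"

definition induced_subgraph :: "'a ugraph \<Rightarrow> 'a set \<Rightarrow> 'a ugraph" where
  "induced_subgraph G W = (W, {e \<in> edges G. e \<subseteq> W})"

definition subgraph :: "'a ugraph \<Rightarrow> 'a ugraph \<Rightarrow> bool" where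
  "subgraph H G \<longleftrightarrow> simple_graph H \<and> verts H \<subseteq> verts G \<and> edges H \<subseteq> edges G"

definition delete_vertex :: "'a ugraph \<Rightarrow> 'a \<Rightarrow> 'a ugraph" where
  "delete_vertex G v = induced_subgraph G (verts G - {v})"

definition delete_edge :: "'a ugraph \<Rightarrow> 'a \<Rightarrow> 'a \<Rightarrow> 'a ugraph" where
  "delete_edge G u v = (verts G, edges G - {{u, v}})"

text \<open>
  The vertex arising from the identification of \<open>u\<close> and \<open>v\<close> is named \<open>u\<close>; requiring two-element
  edges removes the loop, and parallel edges merge because edges form a set.
\<close>

definition contract_edge :: "'a ugraph \<Rightarrow> 'a \<Rightarrow> 'a \<Rightarrow> 'a ugraph" where
  "contract_edge G u v =
     (verts G - {v},
      {e' \<in> (\<lambda>e. (\<lambda>w. if w = v then u else w) ` e) ` edges G. card e' = 2})"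

definition extract_edge :: "'a ugraph \<Rightarrow> 'a \<Rightarrow> 'a \<Rightarrow> 'a ugraph" where
  "extract_edge G u v = induced_subgraph G (verts G - {u, v})"

definition graph_union :: "'a ugraph \<Rightarrow> 'a ugraph \<Rightarrow> 'a ugraph" where
  "graph_union G H = (verts G \<union> verts H, edges G \<union> edges H)"

inductive minor :: "'a ugraph \<Rightarrow> 'a ugraph \<Rightarrow> bool" where
  iso: "simple_graph H \<Longrightarrow> graph_iso G H \<Longrightarrow> minor H G"
| del_vertex: "minor H G \<Longrightarrow> v \<in> verts H \<Longrightarrow> minor (delete_vertex H v) G"
| del_edge: "minor H G \<Longrightarrow> {u, v} \<in> edges H \<Longrightarrow> minor (delete_edge H u v) G"
| contract: "minor H G \<Longrightarrow> {u, v} \<in> edges H \<Longrightarrow> minor (contract_edge H u v) G"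


section \<open>Graph properties\<close>

text \<open>
  Every finite graph is isomorphic to one with vertices in \<^typ>\<open>nat\<close>, so an isomorphism-closed
  class of finite graphs is given by an isomorphism-closed set of such graphs.
\<close>

definition graph_property :: "nat ugraph set \<Rightarrow> bool" where
  "graph_property P \<longleftrightarrow>
     (\<forall>G\<in>P. simple_graph G) \<and>
     (\<forall>G\<in>P. \<forall>H. simple_graph H \<and> graph_iso G H \<longrightarrow> H \<in> P)"

definition finite_up_to_iso :: "nat ugraph set \<Rightarrow> bool" where
  "finite_up_to_iso P \<longleftrightarrow> (\<exists>S. finite S \<and> S \<subseteq> P \<and> (\<forall>G\<in>P. \<exists>H\<in>S. graph_iso G H))"

definition trivial_property :: "nat ugraph set \<Rightarrow> bool" where
  "trivial_property P \<longleftrightarrow> P = {} \<or> finite_up_to_iso P \<or> (\<forall>G. simple_graph G \<longrightarrow> G \<in> P)"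

definition hereditary_property :: "nat ugraph set \<Rightarrow> bool" where
  "hereditary_property P \<longleftrightarrow> (\<forall>G\<in>P. \<forall>W\<subseteq>verts G. induced_subgraph G W \<in> P)"

definition monotone_property :: "nat ugraph set \<Rightarrow> bool" where
  "monotone_property P \<longleftrightarrow> (\<forall>G\<in>P. \<forall>H. subgraph H G \<longrightarrow> H \<in> P)"

definition minor_closed_property :: "nat ugraph set \<Rightarrow> bool" where
  "minor_closed_property P \<longleftrightarrow> (\<forall>G\<in>P. \<forall>H. minor H G \<longrightarrow> H \<in> P)"


section \<open>Harary and chromatic polynomials\<close>

definition good_partitions :: "'a ugraph set \<Rightarrow> 'a ugraph \<Rightarrow> 'a set set set" where
  "good_partitions P G =
     {p. partition_on (verts G) p \<and> (\<forall>B\<in>p. induced_subgraph G B \<in> P)}"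

definition harary_coeff :: "'a ugraph set \<Rightarrow> nat \<Rightarrow> 'a ugraph \<Rightarrow> nat" where
  "harary_coeff P i G = card {p \<in> good_partitions P G. card p = i}"

definition falling_factorial_poly :: "nat \<Rightarrow> int poly" where
  "falling_factorial_poly i = (\<Prod>j<i. [:- int j, 1:])"

text \<open>A partition of the vertex set has at most \<open>card (verts G)\<close> blocks, so the sum is complete.\<close>

definition harary_poly :: "'a ugraph set \<Rightarrow> 'a ugraph \<Rightarrow> int poly" where
  "harary_poly P G =
     (\<Sum>i\<le>card (verts G). of_nat (harary_coeff P i G) * falling_factorial_poly i)"

definition proper_colourings :: "'a ugraph \<Rightarrow> nat \<Rightarrow> ('a \<Rightarrow> nat) set" where
  "proper_colourings G k =
     {c \<in> verts G \<rightarrow>\<^sub>E {1..k}. \<forall>u v. {u, v} \<in> edges G \<longrightarrow> c u \<noteq> c v}"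

text \<open>
  Existence and uniqueness of this polynomial follow from \<open>chromatic_poly_eqI\<close> and
  \<open>chromatic_poly_eq_harary_poly\<close> below.
\<close>

definition chromatic_poly :: "'a ugraph \<Rightarrow> int poly" where
  "chromatic_poly G =
     (THE p. \<forall>k. poly p (int k) = int (card (proper_colourings G k)))"


section \<open>Edge elimination invariants\<close>

definition graph_parameter :: "(nat ugraph \<Rightarrow> 'b) \<Rightarrow> bool" where
  "graph_parameter F \<longleftrightarrow>
     (\<forall>G H. simple_graph G \<and> simple_graph H \<and> graph_iso G H \<longrightarrow> F G = F H)"

text \<open>
  Since a graph parameter is invariant under isomorphism, multiplicativity over disjoint unions
  and the value at the one-vertex graph may be expressed through arbitrary representatives.
\<close>

definition EE_invariant :: "(nat ugraph \<Rightarrow> int poly) \<Rightarrow> bool" where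
  "EE_invariant F \<longleftrightarrow>
     graph_parameter F \<and>
     (\<exists>\<alpha> \<beta> \<gamma>.
        (\<forall>G u v. simple_graph G \<and> {u, v} \<in> edges G \<longrightarrow>
           F G = F (delete_edge G u v) + \<alpha> * F (contract_edge G u v)
                   + \<beta> * F (extract_edge G u v)) \<and>
        F null_graph = 1 \<and>
        (\<forall>v. F ({v}, {}) = \<gamma>) \<and>
        (\<forall>G H. simple_graph G \<and> simple_graph H \<and> verts G \<inter> verts H = {} \<longrightarrow>
           F (graph_union G H) = F G * F H))"


section \<open>Counting colourings\<close>

definition P_colourings :: "'a ugraph set \<Rightarrow> 'a ugraph \<Rightarrow> nat \<Rightarrow> ('a \<Rightarrow> nat) set" where
  "P_colourings P G k =
     {c \<in> verts G \<rightarrow>\<^sub>E {1..k}. \<forall>i\<in>c ` verts G. induced_subgraph G {v \<in> verts G. c v = i} \<in> P}"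

lemma simple_graph_induced_subgraph:
  "simple_graph G \<Longrightarrow> W \<subseteq> verts G \<Longrightarrow> simple_graph (induced_subgraph G W)"
  by (auto simp: simple_graph_def induced_subgraph_def intro: finite_subset)

lemma simple_graph_delete_edge:
  "simple_graph G \<Longrightarrow> simple_graph (delete_edge G u v)"
  by (auto simp: simple_graph_def delete_edge_def)

lemma simple_graph_contract_edge:
  assumes "simple_graph G" "{u, v} \<in> edges G"
  shows "simple_graph (contract_edge G u v)"
proof -
  have "u \<in> verts G" "u \<noteq> v"
    using assms by (auto simp: simple_graph_def)
  with assms(1) show ?thesis
    unfolding simple_graph_def contract_edge_def by fastforce
qed

lemma minor_simple_graph: "minor H G \<Longrightarrow> simple_graph H"
  by (induction rule: minor.induct)
     (auto simp: delete_vertex_def simple_graph_delete_edge simple_graph_contract_edge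
           intro: simple_graph_induced_subgraph)

lemma poly_falling_factorial_poly:
  "poly (falling_factorial_poly i) (int k) = int (\<Prod>j<i. k - j)"
proof (cases "i \<le> k")
  case True
  then show ?thesis
    by (auto simp: falling_factorial_poly_def poly_prod of_nat_diff intro!: prod.cong)
next
  case False
  then have "k \<in> {..<i}" by auto
  then have "(\<Prod>j<i. poly [:- int j, 1:] (int k)) = 0" and "(\<Prod>j<i. k - j) = 0"
    by (force intro!: prod_zero)+
  then show ?thesis
    by (simp only: falling_factorial_poly_def poly_prod of_nat_0)
qed

lemma card_partition_on_le:
  assumes "finite A" "partition_on A p"
  shows "card p \<le> card A"
proof -
  have ne: "\<And>B. B \<in> p \<Longrightarrow> \<exists>x. x \<in> B"
    using partition_onD3[OF assms(2)] by (metis ex_in_conv)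
  then obtain r where r: "\<And>B. B \<in> p \<Longrightarrow> r B \<in> B" by metis
  have "inj_on r p"
    using r partition_onD2[OF assms(2)] by (intro inj_onI) (metis disjointD disjoint_iff)
  moreover have "r ` p \<subseteq> A"
    using r partition_onD1[OF assms(2)] by auto
  ultimately show ?thesis
    using assms(1) by (rule card_inj_on_le)
qed

lemma card_P_colourings:
  assumes "finite (verts G)"
  shows "card (P_colourings P G k) = (\<Sum>p\<in>good_partitions P G. \<Prod>j<card p. k - j)"
proof -
  define V where "V = verts G"
  define blk where "blk = (\<lambda>p v. THE B. B \<in> p \<and> v \<in> (B :: 'a set))"
  have finV: "finite V" using assms by (simp add: V_def)
  define S where
    "S = Sigma (good_partitions P G) (\<lambda>p. {f \<in> p \<rightarrow>\<^sub>E {1..k}. inj_on f p})"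
  define \<Phi> where "\<Phi> = (\<lambda>(p, f). \<lambda>v\<in>V. f (blk p v) :: nat)"
  have part: "partition_on V p" if "p \<in> good_partitions P G" for p
    using that by (auto simp: good_partitions_def V_def)
  have blk: "blk p v = B" if "partition_on V p" "B \<in> p" "v \<in> B" for p v B
    unfolding blk_def
  proof (rule the_equality)
    show "C = B" if "C \<in> p \<and> v \<in> C" for C
      using that partition_onD2[OF \<open>partition_on V p\<close>] \<open>B \<in> p\<close> \<open>v \<in> B\<close>
      by (metis disjointD disjoint_iff)
  qed (use that in auto)
  have blk_in: "blk p v \<in> p" "v \<in> blk p v" if pv: "partition_on V p" "v \<in> V" for p v
  proof -
    obtain B where "B \<in> p" "v \<in> B" using pv(2) partition_onD1[OF pv(1)] by blast
    then show "blk p v \<in> p" "v \<in> blk p v" using blk[OF pv(1)] by auto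
  qed
  have class_eq: "{w \<in> V. f (blk p w) = f B} = B"
    if "partition_on V p" "inj_on f p" "B \<in> p" for p f B
  proof -
    have "B \<subseteq> V" using that partition_onD1 by fastforce
    moreover have "w \<in> B" if "w \<in> V" "f (blk p w) = f B" for w
      using blk_in[OF \<open>partition_on V p\<close> \<open>w \<in> V\<close>] that \<open>B \<in> p\<close>
        inj_onD[OF \<open>inj_on f p\<close>, of "blk p w" B] by simp
    ultimately show ?thesis
      using blk[OF that(1,3)] by auto
  qed
  have recover: "p = (\<lambda>i. {w \<in> V. \<Phi> (p, f) w = i}) ` (\<Phi> (p, f) ` V)"
    and vals: "\<And>B. B \<in> p \<Longrightarrow> {w \<in> V. \<Phi> (p, f) w = f B} = B"
    if pf: "partition_on V p" "inj_on f p" for p f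
  proof -
    show vals: "{w \<in> V. \<Phi> (p, f) w = f B} = B" if "B \<in> p" for B
      using class_eq[OF pf that] by (auto simp: \<Phi>_def)
    have "\<Phi> (p, f) ` V = f ` p"
    proof -
      have "\<exists>v\<in>V. blk p v = B" if "B \<in> p" for B
      proof -
        have "B \<noteq> {}" using partition_onD3[OF pf(1)] that by auto
        then obtain v where "v \<in> B" by auto
        moreover have "B \<subseteq> V" using pf(1) that partition_onD1 by fastforce
        ultimately show ?thesis using blk[OF pf(1) that] by auto
      qed
      then show ?thesis using blk_in[OF pf(1)] by (force simp: \<Phi>_def image_iff)
    qed
    then show "p = (\<lambda>i. {w \<in> V. \<Phi> (p, f) w = i}) ` (\<Phi> (p, f) ` V)"
      using vals by (simp add: image_image)
  qed
  have inj: "inj_on \<Phi> S"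
  proof (rule inj_onI)
    fix x y assume xy: "x \<in> S" "y \<in> S" "\<Phi> x = \<Phi> y"
    obtain p f q g where pq: "x = (p, f)" "y = (q, g)" by (cases x, cases y) auto
    have p: "partition_on V p" "inj_on f p" "f \<in> extensional p"
      and q: "partition_on V q" "inj_on g q" "g \<in> extensional q"
      using xy part by (auto simp: S_def pq PiE_def)
    have "p = q"
      using recover[OF p(1,2)] recover[OF q(1,2)] xy(3) by (simp add: pq)
    moreover have "f = g"
    proof (rule extensionalityI)
      show "f \<in> extensional p" "g \<in> extensional p"
        using p q \<open>p = q\<close> by auto
      fix B assume B: "B \<in> p"
      then obtain v where v: "v \<in> B" using partition_onD3[OF p(1)] by fastforce
      have "v \<in> V" using v B p(1) partition_onD1 by fastforce
      then have "\<Phi> (p, f) v = f B" "\<Phi> (p, g) v = g B"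
        using blk[OF p(1) B v] by (auto simp: \<Phi>_def)
      then show "f B = g B" using xy(3) \<open>p = q\<close> by (simp add: pq)
    qed
    ultimately show "x = y" by (simp add: pq)
  qed
  have img: "\<Phi> ` S = P_colourings P G k"
  proof (intro equalityI subsetI)
    fix c assume "c \<in> \<Phi> ` S"
    then obtain p f where pf: "p \<in> good_partitions P G" "f \<in> p \<rightarrow>\<^sub>E {1..k}" "inj_on f p"
      and c: "c = \<Phi> (p, f)" by (auto simp: S_def)
    note pp = part[OF pf(1)]
    have cV: "c \<in> V \<rightarrow>\<^sub>E {1..k}"
      using pf(2) blk_in[OF pp] by (auto simp: c \<Phi>_def PiE_def Pi_def)
    have "{w \<in> V. c w = i} \<in> p" if "i \<in> c ` V" for i
      using recover[OF pp pf(3)] that unfolding c by blast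
    then show "c \<in> P_colourings P G k"
      using cV pf(1) by (auto simp: P_colourings_def good_partitions_def V_def)
  next
    fix c assume c: "c \<in> P_colourings P G k"
    then have cV: "c \<in> V \<rightarrow>\<^sub>E {1..k}"
      and cP: "\<And>i. i \<in> c ` V \<Longrightarrow> induced_subgraph G {v \<in> V. c v = i} \<in> P"
      by (auto simp: P_colourings_def V_def)
    define p where "p = (\<lambda>i. {w \<in> V. c w = i}) ` (c ` V)"
    define f where "f = (\<lambda>B\<in>p. THE i. \<exists>v\<in>B. c v = i)"
    have f: "f {w \<in> V. c w = c v} = c v" if "v \<in> V" for v
      using that by (auto simp: f_def p_def intro!: the_equality)
    have pp: "partition_on V p"
      by (auto simp: partition_on_def p_def disjoint_def)
    have "p \<in> good_partitions P G"
      using pp cP by (auto simp: good_partitions_def p_def V_def)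
    moreover have "f \<in> p \<rightarrow>\<^sub>E {1..k}"
    proof (rule PiE_I)
      fix B assume "B \<in> p"
      then obtain v where "v \<in> V" "B = {w \<in> V. c w = c v}" by (auto simp: p_def)
      then show "f B \<in> {1..k}" using f cV by (auto simp: PiE_def Pi_def)
    qed (auto simp: f_def)
    moreover have "inj_on f p"
      by (auto simp: inj_on_def p_def f)
    moreover have "c = \<Phi> (p, f)"
    proof (rule extensionalityI)
      show "c \<in> extensional V" using cV by (auto simp: PiE_def)
      show "\<Phi> (p, f) \<in> extensional V" by (auto simp: \<Phi>_def)
      fix v assume v: "v \<in> V"
      have "blk p v = {w \<in> V. c w = c v}"
        by (rule blk[OF pp]) (use v in \<open>auto simp: p_def\<close>)
      then show "c v = \<Phi> (p, f) v" using v f by (simp add: \<Phi>_def)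
    qed
    ultimately show "c \<in> \<Phi> ` S" by (auto simp: S_def)
  qed
  have fin: "finite (good_partitions P G)"
    by (rule finite_subset[OF _ finitely_many_partition_on[OF finV]])
       (auto simp: good_partitions_def V_def)
  have finp: "finite p" if "p \<in> good_partitions P G" for p
    using finite_elements[OF finV part[OF that]] .
  have "card (P_colourings P G k) = card S"
    using card_image[OF inj] by (simp add: img)
  also have "\<dots> = (\<Sum>p\<in>good_partitions P G. card {f \<in> p \<rightarrow>\<^sub>E {1..k}. inj_on f p})"
    unfolding S_def
    by (rule card_SigmaI) (simp_all add: fin finp finite_PiE)
  also have "\<dots> = (\<Sum>p\<in>good_partitions P G. \<Prod>j<card p. k - j)"
  proof (rule sum.cong[OF refl])
    fix p assume p: "p \<in> good_partitions P G"
    show "card {f \<in> p \<rightarrow>\<^sub>E {1..k}. inj_on f p} = (\<Prod>j<card p. k - j)"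
      using card_inj_on_subset_funcset[of p "{1..k}" p] finp[OF p]
      by (simp add: atLeast0LessThan)
  qed
  finally show ?thesis .
qed

theorem poly_harary_poly:
  assumes "simple_graph G"
  shows "poly (harary_poly P G) (int k) = int (card (P_colourings P G k))"
proof -
  have finV: "finite (verts G)" using assms by (simp add: simple_graph_def)
  have fin: "finite (good_partitions P G)"
    by (rule finite_subset[OF _ finitely_many_partition_on[OF finV]])
       (auto simp: good_partitions_def)
  have "(\<Sum>p\<in>good_partitions P G. \<Prod>j<card p. k - j) =
        (\<Sum>i\<le>card (verts G). \<Sum>p\<in>{p \<in> good_partitions P G. card p = i}. \<Prod>j<card p. k - j)"
    by (rule sum.group[symmetric, OF fin])
       (auto simp: good_partitions_def intro: card_partition_on_le[OF finV])
  also have "\<dots> = (\<Sum>i\<le>card (verts G). harary_coeff P i G * (\<Prod>j<i. k - j))"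
    by (rule sum.cong) (auto simp: harary_coeff_def)
  finally have "int (card (P_colourings P G k)) =
      (\<Sum>i\<le>card (verts G). int (harary_coeff P i G) * int (\<Prod>j<i. k - j))"
    by (simp add: card_P_colourings[OF finV])
  then show ?thesis
    by (simp add: harary_poly_def poly_sum poly_falling_factorial_poly)
qed

lemma poly_eqI_nat:
  fixes p q :: "int poly"
  assumes "\<And>k. poly p (int k) = poly q (int k)"
  shows "p = q"
proof (rule ccontr)
  assume "p \<noteq> q"
  then have "finite {x. poly (p - q) x = 0}" by (intro poly_roots_finite) auto
  moreover have "range int \<subseteq> {x. poly (p - q) x = 0}" using assms by auto
  ultimately have "finite (range int)" by (rule rev_finite_subset)
  then show False by (auto dest: finite_imageD)
qed

lemma chromatic_poly_eqI:
  assumes "\<And>k. poly p (int k) = int (card (proper_colourings G k))"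
  shows "chromatic_poly G = p"
  unfolding chromatic_poly_def
  by (rule the_equality) (use assms in \<open>auto intro: poly_eqI_nat\<close>)

theorem chromatic_poly_eq_harary_poly:
  assumes "simple_graph G"
  shows "chromatic_poly G = harary_poly {H. simple_graph H \<and> edges H = {}} G"
proof (rule chromatic_poly_eqI)
  fix k
  let ?E = "{H :: 'a ugraph. simple_graph H \<and> edges H = {}}"
  have "proper_colourings G k = P_colourings ?E G k"
  proof -
    have "(\<forall>u v. {u, v} \<in> edges G \<longrightarrow> c u \<noteq> c v) \<longleftrightarrow>
          (\<forall>i\<in>c ` verts G. induced_subgraph G {v \<in> verts G. c v = i} \<in> ?E)" (is "?L \<longleftrightarrow> ?R")
      for c :: "'a \<Rightarrow> nat"
    proof
      assume L: ?L
      have "e \<notin> edges G" if "e \<subseteq> {v \<in> verts G. c v = i}" for e i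
      proof
        assume e: "e \<in> edges G"
        then have "card e = 2" using assms by (auto simp: simple_graph_def)
        then obtain u v where "e = {u, v}" by (auto simp: card_2_iff)
        then show False using L e that by blast
      qed
      then have "edges (induced_subgraph G {v \<in> verts G. c v = i}) = {}" for i
        by (auto simp: induced_subgraph_def)
      then show ?R using assms by (auto intro: simple_graph_induced_subgraph)
    next
      assume R: ?R
      show ?L
      proof (intro allI impI notI)
        fix u v assume e: "{u, v} \<in> edges G" and c: "c u = c v"
        then have uv: "u \<in> verts G" "v \<in> verts G" using assms by (auto simp: simple_graph_def)
        then have "edges (induced_subgraph G {w \<in> verts G. c w = c u}) = {}" using R by auto
        then show False using e c uv by (auto simp: induced_subgraph_def)
      qed
    qed
    then show ?thesis by (auto simp: proper_colourings_def P_colourings_def)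
  qed
  then show "poly (harary_poly ?E G) (int k) = int (card (proper_colourings G k))"
    by (simp add: poly_harary_poly[OF assms])
qed

end

theory Submission
  imports Defs
begin

text \<open>
  All three closure conditions imply that \<open>P\<close> is hereditary. Evaluated at \<open>1\<close>, the Harary polynomial
  is the indicator function of \<open>P\<close>. If an edge elimination invariant has value \<open>1\<close> at \<open>1\<close> on both
  \<open>K\<^sub>1\<close> and \<open>K\<^sub>2\<close>, then \<open>\<gamma>(1) = 1\<close> and the recurrence for \<open>K\<^sub>2\<close> gives \<open>\<alpha>(1) + \<beta>(1) = 0\<close>. Deletion,
  contraction and extraction all lower the number of edges, so by induction the invariant has
  value \<open>1\<close> at \<open>1\<close> on every graph. Hence, if the Harary polynomial of a non-trivial \<open>P\<close> is an edge
  elimination invariant, then \<open>P\<close> does not contain \<open>K\<^sub>2\<close>, so all its graphs are edgeless; it contains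
  every edgeless graph because the value of the invariant at \<open>n K\<^sub>1\<close> is \<open>\<gamma>\<^sup>n\<close>.
\<close>

section \<open>Simple graphs\<close>

lemma simple_graph_edgeE:
  assumes "simple_graph G" "e \<in> edges G"
  obtains u v where "e = {u, v}" "u \<noteq> v" "u \<in> verts G" "v \<in> verts G"
proof -
  have "card e = 2" "e \<subseteq> verts G"
    using assms by (auto simp: simple_graph_def)
  then show thesis
    using that by (auto simp: card_2_iff)
qed

lemma simple_graph_nonempty_edgesE:
  assumes "edges G \<noteq> {}" "simple_graph G"
  obtains u v where "{u, v} \<in> edges G"
proof -
  obtain e where "e \<in> edges G"
    using assms(1) by blast
  moreover from assms(2) this obtain u v where "e = {u, v}"
    by (rule simple_graph_edgeE)
  ultimately show thesis
    using that by blast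
qed

lemma simple_graph_edgeD:
  assumes "simple_graph G" "{u, v} \<in> edges G"
  shows "u \<in> verts G" "v \<in> verts G" "u \<noteq> v"
  using assms by (auto simp: simple_graph_def)

lemma finite_edges: "simple_graph G \<Longrightarrow> finite (edges G)"
  by (rule finite_subset[of _ "Pow (verts G)"]) (auto simp: simple_graph_def)

lemma simple_graph_edgeless [simp]: "simple_graph (V, {}) \<longleftrightarrow> finite V"
  by (simp add: simple_graph_def)

lemma simple_graph_union:
  "simple_graph G \<Longrightarrow> simple_graph H \<Longrightarrow> simple_graph (graph_union G H)"
  by (auto simp: simple_graph_def graph_union_def)

lemma simple_graph_extract_edge: "simple_graph G \<Longrightarrow> simple_graph (extract_edge G u v)"
  by (simp add: extract_edge_def simple_graph_induced_subgraph)

lemma simple_graph_null_graph [simp]: "simple_graph null_graph"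
  by (simp add: null_graph_def)

lemma simple_graph_verts_empty_iff: "simple_graph G \<Longrightarrow> verts G = {} \<longleftrightarrow> G = null_graph"
  by (cases G) (auto simp: simple_graph_def null_graph_def)

lemma graph_iso_refl: "graph_iso G G"
  unfolding graph_iso_def by (rule exI[of _ id]) auto

definition image_graph :: "('a \<Rightarrow> 'b) \<Rightarrow> 'a ugraph \<Rightarrow> 'b ugraph" where
  "image_graph f G = (f ` verts G, (`) f ` edges G)"

lemma graph_iso_imageE:
  assumes "simple_graph G" "simple_graph H" "graph_iso G H"
  obtains f where "inj_on f (verts G)" "H = image_graph f G"
proof -
  obtain f where bij: "bij_betw f (verts G) (verts H)"
    and adj: "\<And>u v. u \<in> verts G \<Longrightarrow> v \<in> verts G \<Longrightarrow> {u, v} \<in> edges G \<longleftrightarrow> {f u, f v} \<in> edges H"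
    using assms(3) by (auto simp: graph_iso_def)
  have "edges H = (`) f ` edges G"
  proof (intro equalityI subsetI)
    fix e assume "e \<in> edges H"
    then obtain u' v' where "e = {u', v'}" "u' \<in> f ` verts G" "v' \<in> f ` verts G"
      using assms(2) bij unfolding bij_betw_def by (metis simple_graph_edgeE)
    then obtain u v where "e = {f u, f v}" "u \<in> verts G" "v \<in> verts G" by blast
    then have "{u, v} \<in> edges G" and "e = f ` {u, v}"
      using adj \<open>e \<in> edges H\<close> by simp_all
    then show "e \<in> (`) f ` edges G" by (rule rev_image_eqI)
  next
    fix e assume "e \<in> (`) f ` edges G"
    then obtain e' where "e' \<in> edges G" and e: "e = f ` e'" by blast
    then obtain u v where "e' = {u, v}" "u \<in> verts G" "v \<in> verts G"
      using assms(1) simple_graph_edgeE by metis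
    then show "e \<in> edges H"
      using adj \<open>e' \<in> edges G\<close> e by simp
  qed
  then have "H = image_graph f G"
    using bij by (simp add: image_graph_def prod_eq_iff bij_betw_imp_surj_on)
  with bij show thesis
    using that bij_betw_imp_inj_on by blast
qed

lemma induced_subgraph_verts: "simple_graph G \<Longrightarrow> induced_subgraph G (verts G) = G"
  by (cases G) (auto simp: induced_subgraph_def simple_graph_def)

lemma induced_subgraph_empty: "simple_graph G \<Longrightarrow> induced_subgraph G {} = null_graph"
  by (auto simp: induced_subgraph_def null_graph_def simple_graph_def)

lemma induced_subgraph_singleton:
  assumes "simple_graph G"
  shows "induced_subgraph G {v} = ({v}, {})"
proof -
  have "\<not> e \<subseteq> {v}" if "e \<in> edges G" for e
    using assms that by (rule simple_graph_edgeE) auto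
  then show ?thesis by (auto simp: induced_subgraph_def)
qed

lemma induced_subgraph_edge:
  assumes "simple_graph G" "{u, v} \<in> edges G"
  shows "induced_subgraph G {u, v} = ({u, v}, {{u, v}})"
proof -
  have "e = {u, v}" if "e \<in> edges G" "e \<subseteq> {u, v}" for e
    using assms(1) that(1) by (rule simple_graph_edgeE) (use that(2) in auto)
  then show ?thesis
    using assms(2) by (auto simp: induced_subgraph_def)
qed

lemma card_edges_delete_edge_less:
  assumes "simple_graph G" "{u, v} \<in> edges G"
  shows "card (edges (delete_edge G u v)) < card (edges G)"
  using card_Diff1_less[OF finite_edges[OF assms(1)] assms(2)] by (simp add: delete_edge_def)

lemma contract_edge_eq_image_graph:
  assumes "simple_graph G" "{u, v} \<in> edges G"
  shows "contract_edge G u v = image_graph (\<lambda>w. if w = v then u else w) (delete_edge G u v)"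
proof -
  let ?r = "\<lambda>w. if w = v then u else w"
  have "card (?r ` e) = 2 \<longleftrightarrow> e \<noteq> {u, v}" if "e \<in> edges G" for e
  proof -
    obtain a b where "e = {a, b}" "a \<noteq> b"
      using assms(1) \<open>e \<in> edges G\<close> by (rule simple_graph_edgeE)
    then have "card (?r ` e) = 2 \<longleftrightarrow> ?r a \<noteq> ?r b"
      by (auto simp: card_insert_if)
    also have "\<dots> \<longleftrightarrow> e \<noteq> {u, v}"
      using \<open>e = {a, b}\<close> \<open>a \<noteq> b\<close> simple_graph_edgeD(3)[OF assms]
      by (auto simp: doubleton_eq_iff)
    finally show ?thesis .
  qed
  then have "{e \<in> edges G. card (?r ` e) = 2} = edges (delete_edge G u v)"
    unfolding delete_edge_def by auto
  moreover have "edges (contract_edge G u v) = (`) ?r ` {e \<in> edges G. card (?r ` e) = 2}"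
    unfolding contract_edge_def by (simp only: snd_conv) blast
  moreover have "verts (contract_edge G u v) = ?r ` verts (delete_edge G u v)"
    using simple_graph_edgeD[OF assms] by (auto simp: contract_edge_def delete_edge_def)
  ultimately show ?thesis
    by (simp add: image_graph_def prod_eq_iff)
qed

lemma card_edges_contract_edge_less:
  assumes "simple_graph G" "{u, v} \<in> edges G"
  shows "card (edges (contract_edge G u v)) < card (edges G)"
proof -
  have "card (edges (contract_edge G u v)) \<le> card (edges (delete_edge G u v))"
    unfolding contract_edge_eq_image_graph[OF assms] image_graph_def snd_conv
    by (intro card_image_le finite_edges simple_graph_delete_edge assms)
  also have "\<dots> < card (edges G)"
    using assms by (rule card_edges_delete_edge_less)
  finally show ?thesis .
qed

lemma card_edges_extract_edge_less:
  assumes "simple_graph G" "{u, v} \<in> edges G"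
  shows "card (edges (extract_edge G u v)) < card (edges G)"
proof -
  have "edges (extract_edge G u v) \<subseteq> edges (delete_edge G u v)"
    by (auto simp: extract_edge_def induced_subgraph_def delete_edge_def)
  then have "card (edges (extract_edge G u v)) \<le> card (edges (delete_edge G u v))"
    by (intro card_mono finite_edges simple_graph_delete_edge assms)
  also have "\<dots> < card (edges G)"
    using assms by (rule card_edges_delete_edge_less)
  finally show ?thesis .
qed

lemma edge_elimination_induct [consumes 1, case_names edgeless edge]:
  assumes "simple_graph G"
    and edgeless: "\<And>V. finite V \<Longrightarrow> Q (V, {})"
    and edge: "\<And>G u v. simple_graph G \<Longrightarrow> {u, v} \<in> edges G \<Longrightarrow> Q (delete_edge G u v) \<Longrightarrow>
      Q (contract_edge G u v) \<Longrightarrow> Q (extract_edge G u v) \<Longrightarrow> Q G"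
  shows "Q G"
  using assms(1)
proof (induction "card (edges G)" arbitrary: G rule: less_induct)
  case less
  show ?case
  proof (cases "edges G = {}")
    case True
    then show ?thesis
      using edgeless[of "verts G"] less.prems by (cases G) (simp add: simple_graph_def)
  next
    case False
    then obtain u v where uv: "{u, v} \<in> edges G"
      using less.prems by (rule simple_graph_nonempty_edgesE)
    show ?thesis
    proof (rule edge[OF less.prems uv])
      show "Q (delete_edge G u v)"
        by (intro less card_edges_delete_edge_less simple_graph_delete_edge uv)
      show "Q (contract_edge G u v)"
        by (intro less card_edges_contract_edge_less simple_graph_contract_edge uv)
      show "Q (extract_edge G u v)"
        by (intro less card_edges_extract_edge_less simple_graph_extract_edge uv)
    qed
  qed
qed

section \<open>Hereditary properties\<close>

definition edgeless_graphs :: "'a ugraph set" where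
  "edgeless_graphs = {G. simple_graph G \<and> edges G = {}}"

lemma graph_property_simple: "graph_property P \<Longrightarrow> G \<in> P \<Longrightarrow> simple_graph G"
  by (simp add: graph_property_def)

lemma hereditary_propertyD:
  "hereditary_property P \<Longrightarrow> G \<in> P \<Longrightarrow> W \<subseteq> verts G \<Longrightarrow> induced_subgraph G W \<in> P"
  by (simp add: hereditary_property_def)

lemma monotone_imp_hereditary:
  assumes "graph_property P" "monotone_property P"
  shows "hereditary_property P"
  unfolding hereditary_property_def
proof (intro ballI allI impI)
  fix G W assume "G \<in> P" "W \<subseteq> verts G"
  moreover from this have "subgraph (induced_subgraph G W) G"
    using graph_property_simple[OF assms(1)] simple_graph_induced_subgraph[of G W]
    by (auto simp: subgraph_def induced_subgraph_def)
  ultimately show "induced_subgraph G W \<in> P"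
    using assms(2) unfolding monotone_property_def by blast
qed

lemma minor_induced_subgraph:
  assumes "simple_graph G" "W \<subseteq> verts G"
  shows "minor (induced_subgraph G W) G"
proof -
  have "minor (induced_subgraph G (verts G - D)) G" if "finite D" "D \<subseteq> verts G" for D
    using that
  proof (induction D)
    case empty
    show ?case
      using assms(1) by (simp add: induced_subgraph_verts minor.iso graph_iso_refl)
  next
    case (insert v D)
    let ?H = "induced_subgraph G (verts G - D)"
    have "minor (delete_vertex ?H v) G"
      using insert by (intro minor.del_vertex) (auto simp: induced_subgraph_def)
    moreover have "delete_vertex ?H v = induced_subgraph G (verts G - insert v D)"
      by (auto simp: delete_vertex_def induced_subgraph_def)
    ultimately show ?case by simp
  qed
  from this[of "verts G - W"] show ?thesis
    using assms by (simp add: simple_graph_def double_diff)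
qed

lemma minor_closed_imp_hereditary:
  assumes "graph_property P" "minor_closed_property P"
  shows "hereditary_property P"
  using assms(2) minor_induced_subgraph graph_property_simple[OF assms(1)]
  unfolding hereditary_property_def minor_closed_property_def by blast

lemma finite_imp_finite_up_to_iso: "finite P \<Longrightarrow> finite_up_to_iso P"
  unfolding finite_up_to_iso_def using graph_iso_refl by blast

lemma ex_nonnull_graph_if_infinite_up_to_iso:
  assumes "graph_property P" "\<not> finite_up_to_iso P"
  shows "\<exists>G\<in>P. verts G \<noteq> {}"
proof (rule ccontr)
  assume "\<not> ?thesis"
  then have "P \<subseteq> {null_graph}"
    using graph_property_simple[OF assms(1)] by (auto simp flip: simple_graph_verts_empty_iff)
  then show False
    using assms(2) finite_imp_finite_up_to_iso finite_subset by blast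
qed

section \<open>Proper colourings\<close>

lemma proper_colourings_PiE: "c \<in> proper_colourings G k \<Longrightarrow> c \<in> verts G \<rightarrow>\<^sub>E {1..k}"
  by (simp add: proper_colourings_def)

lemma proper_colourings_altdef:
  assumes "simple_graph G"
  shows "proper_colourings G k = {c \<in> verts G \<rightarrow>\<^sub>E {1..k}. \<forall>e\<in>edges G. inj_on c e}"
proof -
  have "(\<forall>u v. {u, v} \<in> edges G \<longrightarrow> c u \<noteq> c v) \<longleftrightarrow> (\<forall>e\<in>edges G. inj_on c e)" for c :: "'a \<Rightarrow> nat"
  proof safe
    fix e assume proper: "\<forall>u v. {u, v} \<in> edges G \<longrightarrow> c u \<noteq> c v" and "e \<in> edges G"
    obtain u v where "e = {u, v}" "u \<noteq> v"
      using assms \<open>e \<in> edges G\<close> by (rule simple_graph_edgeE)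
    with proper \<open>e \<in> edges G\<close> show "inj_on c e" by auto
  next
    fix u v assume "\<forall>e\<in>edges G. inj_on c e" "{u, v} \<in> edges G" "c u = c v"
    then show False
      using simple_graph_edgeD(3)[OF assms] by (meson inj_onD insertCI)
  qed
  then show ?thesis
    by (simp add: proper_colourings_def)
qed

lemma proper_colourings_eq_P_colourings_edgeless:
  assumes "simple_graph G"
  shows "proper_colourings G k = P_colourings edgeless_graphs G k"
proof -
  have class_edgeless: "induced_subgraph G {v \<in> verts G. c v = i} \<in> edgeless_graphs \<longleftrightarrow>
      (\<forall>e\<in>edges G. \<not> e \<subseteq> {v \<in> verts G. c v = i})" for c :: "'a \<Rightarrow> nat" and i
    using simple_graph_induced_subgraph[OF assms, of "{v \<in> verts G. c v = i}"]
    by (auto simp: edgeless_graphs_def induced_subgraph_def)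
  have inj_on_edge: "inj_on c e \<longleftrightarrow> (\<forall>i\<in>c ` verts G. \<not> e \<subseteq> {v \<in> verts G. c v = i})"
    if "e \<in> edges G" for c :: "'a \<Rightarrow> nat" and e
    using assms that by (rule simple_graph_edgeE) auto
  show ?thesis
    unfolding proper_colourings_altdef[OF assms] P_colourings_def class_edgeless
    by (auto simp: inj_on_edge)
qed

lemma poly_chromatic_poly:
  "simple_graph G \<Longrightarrow> poly (chromatic_poly G) (int k) = int (card (proper_colourings G k))"
  by (simp add: chromatic_poly_eq_harary_poly poly_harary_poly edgeless_graphs_def
      proper_colourings_eq_P_colourings_edgeless)

lemma finite_proper_colourings: "simple_graph G \<Longrightarrow> finite (proper_colourings G k)"
  unfolding proper_colourings_def simple_graph_def
  by (rule finite_subset[of _ "verts G \<rightarrow>\<^sub>E {1..k}"]) (auto intro: finite_PiE)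

lemma inj_on_pullback: "inj_on (\<lambda>c. restrict (c \<circ> f) A) (extensional (f ` A))"
proof (rule inj_onI)
  fix c d
  assume c: "c \<in> extensional (f ` A)" and d: "d \<in> extensional (f ` A)"
    and eq: "restrict (c \<circ> f) A = restrict (d \<circ> f) A"
  have "c (f a) = d (f a)" if "a \<in> A" for a
    using fun_cong[OF eq, of a] that by simp
  then show "c = d"
    by (intro extensionalityI[OF c d]) auto
qed

lemma pullback_proper_colouring_iff:
  assumes "simple_graph G" "simple_graph (image_graph f G)" "c \<in> extensional (f ` verts G)"
  shows "restrict (c \<circ> f) (verts G) \<in> proper_colourings G k \<longleftrightarrow>
    c \<in> proper_colourings (image_graph f G) k"
proof -
  have "inj_on (restrict (c \<circ> f) (verts G)) e \<longleftrightarrow> inj_on c (f ` e)" if "e \<in> edges G" for e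
  proof -
    have e: "card e = 2" "card (f ` e) = 2" "e \<subseteq> verts G"
      using assms(1,2) that by (auto simp: simple_graph_def image_graph_def)
    then have "inj_on f e"
      by (intro eq_card_imp_inj_on) (auto intro: card_ge_0_finite)
    moreover have "inj_on (restrict (c \<circ> f) (verts G)) e \<longleftrightarrow> inj_on (c \<circ> f) e"
      using e(3) by (intro inj_on_cong) auto
    ultimately show ?thesis
      by (simp add: comp_inj_on_iff)
  qed
  moreover have "restrict (c \<circ> f) (verts G) \<in> verts G \<rightarrow>\<^sub>E {1..k} \<longleftrightarrow> c \<in> f ` verts G \<rightarrow>\<^sub>E {1..k}"
    using assms(3) by (simp add: PiE_iff)
  ultimately show ?thesis
    unfolding proper_colourings_altdef[OF assms(1)] proper_colourings_altdef[OF assms(2)]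
    by (simp add: image_graph_def)
qed

lemma bij_betw_pullback_proper_colourings:
  assumes "simple_graph G" "simple_graph (image_graph f G)"
  shows "bij_betw (\<lambda>c. restrict (c \<circ> f) (verts G)) (proper_colourings (image_graph f G) k)
    {d \<in> proper_colourings G k. \<forall>u\<in>verts G. \<forall>v\<in>verts G. f u = f v \<longrightarrow> d u = d v}"
    (is "bij_betw ?pull ?C ?D")
proof (rule bij_betw_imageI)
  have C_extensional: "?C \<subseteq> extensional (f ` verts G)"
    using proper_colourings_PiE by (fastforce simp: image_graph_def PiE_iff)
  then show "inj_on ?pull ?C"
    by (rule inj_on_subset[OF inj_on_pullback])
  show "?pull ` ?C = ?D"
  proof (intro equalityI subsetI)
    fix d assume "d \<in> ?pull ` ?C"
    then obtain c where c: "c \<in> ?C" and d: "d = ?pull c" by blast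
    then have "c \<in> extensional (f ` verts G)"
      using C_extensional by blast
    then show "d \<in> ?D"
      using c pullback_proper_colouring_iff[OF assms] by (simp add: d)
  next
    fix d assume "d \<in> ?D"
    then have proper: "d \<in> proper_colourings G k"
      and fibrewise: "\<And>u v. u \<in> verts G \<Longrightarrow> v \<in> verts G \<Longrightarrow> f u = f v \<Longrightarrow> d u = d v"
      by blast+
    define c where "c = (\<lambda>w\<in>f ` verts G. d (inv_into (verts G) f w))"
    have "d v = c (f v)" if "v \<in> verts G" for v
      using that fibrewise[OF that, of "inv_into (verts G) f (f v)"]
      by (simp add: c_def inv_into_into f_inv_into_f)
    then have "restrict d (verts G) = ?pull c"
      by (intro restrict_ext) simp
    moreover have "restrict d (verts G) = d"
      by (rule PiE_restrict[OF proper_colourings_PiE[OF proper]])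
    ultimately have "d = ?pull c" by simp
    moreover have "c \<in> extensional (f ` verts G)"
      by (simp add: c_def)
    ultimately show "d \<in> ?pull ` ?C"
      using proper pullback_proper_colouring_iff[OF assms] by blast
  qed
qed

lemma card_proper_colourings_iso:
  assumes "simple_graph G" "simple_graph H" "graph_iso G H"
  shows "card (proper_colourings G k) = card (proper_colourings H k)"
proof -
  obtain f where inj: "inj_on f (verts G)" and H: "H = image_graph f G"
    using assms by (rule graph_iso_imageE)
  have "{d \<in> proper_colourings G k. \<forall>u\<in>verts G. \<forall>v\<in>verts G. f u = f v \<longrightarrow> d u = d v} =
      proper_colourings G k"
    using inj by (auto dest: inj_onD)
  then show ?thesis
    using bij_betw_same_card[OF bij_betw_pullback_proper_colourings[of G f k]] assms(1,2)
    by (simp add: H)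
qed

lemma proper_colourings_eq_delete_edge:
  assumes "simple_graph G" "{u, v} \<in> edges G"
  shows "proper_colourings G k = {c \<in> proper_colourings (delete_edge G u v) k. c u \<noteq> c v}"
proof -
  have edges: "edges G = insert {u, v} (edges (delete_edge G u v))"
    using assms(2) by (auto simp: delete_edge_def)
  have "(\<forall>e\<in>edges G. inj_on c e) \<longleftrightarrow> c u \<noteq> c v \<and> (\<forall>e\<in>edges (delete_edge G u v). inj_on c e)"
    for c :: "'a \<Rightarrow> nat"
    using simple_graph_edgeD(3)[OF assms] by (subst edges) auto
  moreover have "verts (delete_edge G u v) = verts G"
    by (simp add: delete_edge_def)
  ultimately show ?thesis
    unfolding proper_colourings_altdef[OF assms(1)]
      proper_colourings_altdef[OF simple_graph_delete_edge[OF assms(1)]] by auto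
qed

lemma card_proper_colourings_contract_edge:
  assumes "simple_graph G" "{u, v} \<in> edges G"
  shows "card (proper_colourings (contract_edge G u v) k) =
    card {c \<in> proper_colourings (delete_edge G u v) k. c u = c v}"
proof -
  let ?D = "delete_edge G u v" and ?r = "\<lambda>w. if w = v then u else w"
  have "(\<forall>x\<in>verts ?D. \<forall>y\<in>verts ?D. ?r x = ?r y \<longrightarrow> c x = c y) \<longleftrightarrow> c u = c v"
    for c :: "'a \<Rightarrow> nat"
    using simple_graph_edgeD[OF assms] unfolding delete_edge_def fst_conv by metis
  then show ?thesis
    using bij_betw_same_card[OF bij_betw_pullback_proper_colourings[of ?D ?r k]]
      simple_graph_delete_edge[OF assms(1), of u v] simple_graph_contract_edge[OF assms]
    by (simp only: contract_edge_eq_image_graph[OF assms])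
qed

lemma card_proper_colourings_delete_edge:
  assumes "simple_graph G" "{u, v} \<in> edges G"
  shows "card (proper_colourings (delete_edge G u v) k) =
    card (proper_colourings G k) + card (proper_colourings (contract_edge G u v) k)"
proof -
  let ?D = "proper_colourings (delete_edge G u v) k"
  have "finite ?D"
    using assms(1) by (intro finite_proper_colourings simple_graph_delete_edge)
  moreover have "?D = {c \<in> ?D. c u \<noteq> c v} \<union> {c \<in> ?D. c u = c v}" by blast
  ultimately have "card ?D = card {c \<in> ?D. c u \<noteq> c v} + card {c \<in> ?D. c u = c v}"
    by (subst card_Un_disjoint[symmetric]) auto
  then show ?thesis
    by (simp flip: proper_colourings_eq_delete_edge[OF assms]
        add: card_proper_colourings_contract_edge[OF assms])
qed

lemma card_proper_colourings_union:
  assumes "simple_graph G" "simple_graph H" and disjoint: "verts G \<inter> verts H = {}"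
  shows "card (proper_colourings (graph_union G H) k) =
    card (proper_colourings G k) * card (proper_colourings H k)"
proof -
  let ?U = "proper_colourings (graph_union G H) k"
  let ?GH = "proper_colourings G k \<times> proper_colourings H k"
  let ?split = "\<lambda>c. (restrict c (verts G), restrict c (verts H))"
  let ?glue = "\<lambda>(c, d) v. if v \<in> verts G then c v else d v"
  have "bij_betw ?split ?U ?GH"
  proof (rule bij_betw_byWitness[where f' = ?glue])
    show "\<forall>c\<in>?U. ?glue (?split c) = c"
      by (auto simp: proper_colourings_def graph_union_def fun_eq_iff PiE_def extensional_def)
    show "\<forall>cd\<in>?GH. ?split (?glue cd) = cd"
      using disjoint by (auto simp: proper_colourings_def fun_eq_iff PiE_def extensional_def)
    note ends_G = simple_graph_edgeD(1,2)[OF assms(1)]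
    note ends_H = simple_graph_edgeD(1,2)[OF assms(2)]
    have ends_H_notin_G: "u \<notin> verts G" "v \<notin> verts G" if "{u, v} \<in> edges H" for u v
      using ends_H[OF that] disjoint by auto
    show "?split ` ?U \<subseteq> ?GH"
      using ends_G ends_H by (auto simp: proper_colourings_def graph_union_def)
    show "?glue ` ?GH \<subseteq> ?U"
      using ends_G ends_H ends_H_notin_G
      by (auto simp: proper_colourings_def graph_union_def PiE_def Pi_def extensional_def)
  qed
  then have "card ?U = card ?GH"
    by (rule bij_betw_same_card)
  then show ?thesis
    by (simp add: card_cartesian_product)
qed

section \<open>Edge elimination invariants\<close>

lemma harary_poly_null_graph: "harary_poly P null_graph = 1"
proof -
  have "{p \<in> good_partitions P null_graph. card p = 0} = {{}}"
    by (auto simp: good_partitions_def null_graph_def partition_on_def)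
  then show ?thesis
    by (simp add: harary_poly_def harary_coeff_def falling_factorial_poly_def null_graph_def)
qed

lemma EE_invariant_cong:
  assumes "\<And>G. simple_graph G \<Longrightarrow> F G = F' G"
  shows "EE_invariant F \<longleftrightarrow> EE_invariant F'"
proof -
  have "F null_graph = F' null_graph"
    by (simp add: assms)
  then show ?thesis
    unfolding EE_invariant_def graph_parameter_def
    by (simp add: assms simple_graph_delete_edge simple_graph_contract_edge
        simple_graph_extract_edge simple_graph_union cong: conj_cong imp_cong)
qed

theorem EE_invariant_chromatic_poly: "EE_invariant chromatic_poly"
  unfolding EE_invariant_def
proof (intro conjI exI allI impI)
  show "graph_parameter chromatic_poly"
    unfolding graph_parameter_def
    by (auto intro!: poly_eqI_nat simp: poly_chromatic_poly card_proper_colourings_iso)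
  show "chromatic_poly G = chromatic_poly (delete_edge G u v)
      + (-1) * chromatic_poly (contract_edge G u v) + 0 * chromatic_poly (extract_edge G u v)"
    if "simple_graph G \<and> {u, v} \<in> edges G" for G :: "nat ugraph" and u v
    using that
    by (intro poly_eqI_nat) (simp add: poly_chromatic_poly simple_graph_delete_edge
        simple_graph_contract_edge card_proper_colourings_delete_edge)
  show "chromatic_poly null_graph = 1"
    by (simp add: chromatic_poly_eq_harary_poly harary_poly_null_graph)
  show "chromatic_poly ({v}, {}) = [:0, 1:]" for v :: nat
    by (intro poly_eqI_nat) (simp add: poly_chromatic_poly proper_colourings_def card_PiE)
  show "chromatic_poly (graph_union G H) = chromatic_poly G * chromatic_poly H"
    if "simple_graph G \<and> simple_graph H \<and> verts G \<inter> verts H = {}" for G H :: "nat ugraph"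
    using that
    by (intro poly_eqI_nat)
      (simp add: poly_chromatic_poly card_proper_colourings_union simple_graph_union)
qed

lemma EE_invariant_edgeless:
  assumes "EE_invariant F" "finite V"
  shows "F (V, {}) = F ({w}, {}) ^ card V"
  using assms(2)
proof (induction V)
  case empty
  then show ?case
    using assms(1) by (auto simp: EE_invariant_def null_graph_def)
next
  case (insert v V)
  have "F (insert v V, {}) = F (graph_union ({v}, {}) (V, {}))"
    by (simp add: graph_union_def)
  also have "\<dots> = F ({v}, {}) * F (V, {})"
    using assms(1) insert.hyps unfolding EE_invariant_def by auto
  also have "F ({v}, {}) = F ({w}, {})"
    using assms(1) unfolding EE_invariant_def by metis
  finally show ?case
    using insert by simp
qed

lemma poly_EE_invariant_eq_1:
  assumes "EE_invariant F" "simple_graph G" "u \<noteq> v"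
    and K1: "poly (F ({w}, {})) x = 1" and K2: "poly (F ({u, v}, {{u, v}})) x = 1"
  shows "poly (F G) x = 1"
proof -
  obtain \<alpha> \<beta> where recurrence: "\<And>G u v. simple_graph G \<Longrightarrow> {u, v} \<in> edges G \<Longrightarrow>
      F G = F (delete_edge G u v) + \<alpha> * F (contract_edge G u v) + \<beta> * F (extract_edge G u v)"
    using assms(1) unfolding EE_invariant_def by blast
  have edgeless: "poly (F (V, {})) x = 1" if "finite V" for V
    using EE_invariant_edgeless[OF assms(1) that, of w] K1 by simp
  let ?K = "({u, v}, {{u, v}})"
  have "delete_edge ?K u v = ({u, v}, {})" "contract_edge ?K u v = ({u}, {})"
    "extract_edge ?K u v = ({}, {})"
    using assms(3)
    by (auto simp: delete_edge_def contract_edge_def extract_edge_def induced_subgraph_def)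
  moreover have "simple_graph ?K"
    using assms(3) by (simp add: simple_graph_def)
  ultimately have "poly \<alpha> x + poly \<beta> x = 0"
    using recurrence[of ?K u v] K2 by (simp add: edgeless)
  with assms(2) show ?thesis
    by (induction rule: edge_elimination_induct) (simp_all add: edgeless recurrence)
qed

section \<open>Harary polynomials that are edge elimination invariants\<close>

lemma poly_harary_poly_1:
  assumes "simple_graph G" "null_graph \<in> P"
  shows "poly (harary_poly P G) 1 = of_bool (G \<in> P)"
proof (cases "verts G = {}")
  case True
  then show ?thesis
    using assms by (simp add: simple_graph_verts_empty_iff harary_poly_null_graph)
next
  case False
  let ?const = "\<lambda>v\<in>verts G. 1 :: nat"
  have "P_colourings P G 1 =
      {c \<in> {?const}. \<forall>i\<in>c ` verts G. induced_subgraph G {v \<in> verts G. c v = i} \<in> P}"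
    unfolding P_colourings_def by (auto simp: PiE_def extensional_def fun_eq_iff Pi_def)
  also have "\<dots> = (if G \<in> P then {?const} else {})"
    using False induced_subgraph_verts[OF assms(1)] by auto
  finally show ?thesis
    using poly_harary_poly[OF assms(1), of P 1] by simp
qed

lemma EE_invariant_harary_imp_edgeless:
  assumes property: "graph_property P" and nontrivial: "\<not> trivial_property P"
    and hereditary: "hereditary_property P" and EE: "EE_invariant (harary_poly P)"
  shows "P = edgeless_graphs"
proof -
  note simple = graph_property_simple[OF property]
  note induced = hereditary_propertyD[OF hereditary]
  obtain G\<^sub>0 w where "G\<^sub>0 \<in> P" "w \<in> verts G\<^sub>0"
    using ex_nonnull_graph_if_infinite_up_to_iso[OF property] nontrivial
    by (auto simp: trivial_property_def)
  then have null: "null_graph \<in> P" and K1: "({w}, {}) \<in> P"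
    using induced[of G\<^sub>0 "{}"] induced[of G\<^sub>0 "{w}"] simple[of G\<^sub>0]
    by (simp_all add: induced_subgraph_empty induced_subgraph_singleton)
  note at_1 = poly_harary_poly_1[OF _ null]
  have K1_at_1: "poly (harary_poly P ({w}, {})) 1 = 1"
    using K1 by (simp add: at_1)
  have "edges G = {}" if "G \<in> P" for G
  proof (rule ccontr)
    assume "edges G \<noteq> {}"
    then obtain u v where uv: "{u, v} \<in> edges G"
      using simple[OF \<open>G \<in> P\<close>] by (rule simple_graph_nonempty_edgesE)
    note ends = simple_graph_edgeD[OF simple[OF that] uv]
    have "({u, v}, {{u, v}}) \<in> P"
      using induced[OF that, of "{u, v}"] ends induced_subgraph_edge[OF simple[OF that] uv] by simp
    then have "poly (harary_poly P ({u, v}, {{u, v}})) 1 = 1"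
      by (simp add: at_1 simple)
    then have "H \<in> P" if "simple_graph H" for H
      using poly_EE_invariant_eq_1[OF EE that ends(3) K1_at_1] that by (simp add: at_1)
    then show False
      using nontrivial by (simp add: trivial_property_def)
  qed
  moreover have "(V, {}) \<in> P" if "finite V" for V
    using at_1[of "(V, {})"] EE_invariant_edgeless[OF EE that, of w] K1_at_1 that by simp
  ultimately show ?thesis
    using simple by (force simp: edgeless_graphs_def)
qed

theorem theorem10:
  fixes P :: "nat ugraph set"
  assumes "graph_property P"
    and "\<not> trivial_property P"
    and "minor_closed_property P \<or> monotone_property P \<or> hereditary_property P"
  shows "EE_invariant (harary_poly P) \<longleftrightarrow>
           (\<forall>G. simple_graph G \<longrightarrow> harary_poly P G = chromatic_poly G)"
proof
  assume "EE_invariant (harary_poly P)"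
  moreover have "hereditary_property P"
    using assms(1,3) minor_closed_imp_hereditary monotone_imp_hereditary by blast
  ultimately have "P = edgeless_graphs"
    using EE_invariant_harary_imp_edgeless assms(1,2) by blast
  then show "\<forall>G. simple_graph G \<longrightarrow> harary_poly P G = chromatic_poly G"
    by (simp add: chromatic_poly_eq_harary_poly edgeless_graphs_def)
next
  assume "\<forall>G. simple_graph G \<longrightarrow> harary_poly P G = chromatic_poly G"
  then have "EE_invariant (harary_poly P) \<longleftrightarrow> EE_invariant chromatic_poly"
    by (intro EE_invariant_cong) blast
  then show "EE_invariant (harary_poly P)"
    using EE_invariant_chromatic_poly by simp
qed

end
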